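(* Let $b\ge 2$ be an integer. Let $d_1,d_2,d_3,\dots$ be independent random variables with $d_1$ uniform on $\{1,\dots,b-1\}$ and $d_j$ uniform on $\{0,1,\dots,b-1\}$ for $j\ge 2$. For each integer $n\ge 0$ let $a_b(n)$ be the probability that there is a $k\ge 0$ with $d_1+\dots+d_k=n$. Then, as formal power series in $x$, $$\sum_{n=0}^{\infty} a_b(n)\,x^n = 1+\frac{x(1-x^{b-1})}{(b-1)(1-x)}+\frac{\left(-1+x^{b-1}\right)^2x^2}{\left(-bx+x^b+b-1\right)(b-1)(1-x)}.$$
   Context: The sequence $d_1,d_2,\dots$ models a uniformly random string of members of $\{0,1,\dots,b-1\}$ that definitely starts with a nonzero entry. The empty partial sum ($k=0$) equals $0$, so $a_b(0)=1$. *)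

theory Defs
  imports "HOL-Probability.Probability" "HOL-Computational_Algebra.Formal_Power_Series"
begin

text \<open>
  The probability that some partial sum of the digits \<open>d 1, d 2, \<dots>\<close> equals \<open>n\<close>. The empty
  partial sum (\<open>k = 0\<close>) is included; the value \<open>d 0\<close> is never used.
\<close>

definition hit_prob :: "'w measure \<Rightarrow> (nat \<Rightarrow> 'w \<Rightarrow> nat) \<Rightarrow> nat \<Rightarrow> real" where
  "hit_prob M d n = measure M {\<omega> \<in> space M. \<exists>k::nat. (\<Sum>j = 1..k. d j \<omega>) = n}"

end

theory Submission
  imports Defs
begin

text \<open>
  Read the partial sums as a walk on the natural numbers that starts at \<open>0\<close> and never moves
  left. Such a walk may wait at a site, but once it leaves it cannot come back. So a site
  \<open>n \<ge> 1\<close> that is reached at all is occupied for a geometrically distributed number of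
  consecutive times, with mean \<open>1 / (1 - u 0)\<close> where \<open>u 0\<close> is the probability of a zero
  step. Hence the hitting probability is \<open>1 - u 0\<close> times the expected number \<open>green n\<close> of
  times \<open>k \<ge> 1\<close> spent at \<open>n\<close> (\<open>hit_prob_eq_green\<close>).

  Expected occupation numbers, unlike hitting probabilities, are additive over time: conditioning
  on the latest step gives the renewal equation \<open>G = V + U G\<close> for the generating functions of
  \<open>green\<close>, of the first step and of the later steps (\<open>green_renewal\<close>). Together these give
  \<open>(A - 1) (1 - U) = (1 - u 0) V\<close> for the generating function \<open>A\<close> of the hitting
  probabilities (\<open>hit_prob_fps_eq\<close>).

  For digits in base \<open>b\<close>, the series \<open>U\<close> and \<open>V\<close> are finite geometric sums, and the
  equation becomes \<open>Q (A - 1) = Y\<close> with \<open>Q = b - 1 - b x + x^b\<close> and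
  \<open>Y = x (1 - x^(b-1))\<close>. The closed form to be proved is \<open>1 + Y/C + Y^2/(Q C)\<close> with
  \<open>C = (b - 1) (1 - x)\<close>; since \<open>C = Q + Y\<close>, it collapses to \<open>1 + Y/Q\<close>.
\<close>

section \<open>Convolution for independent variables\<close>

lemma (in prob_space) prob_add_eq_convolution:
  fixes X Y :: "'a \<Rightarrow> nat"
  assumes ind: "indep_var (count_space UNIV) X (count_space UNIV) Y"
  shows "prob {\<omega>\<in>space M. X \<omega> + Y \<omega> = n} =
    (\<Sum>m\<le>n. prob {\<omega>\<in>space M. X \<omega> = m} * prob {\<omega>\<in>space M. Y \<omega> = n - m})"
proof -
  have [measurable]: "X \<in> measurable M (count_space UNIV)" "Y \<in> measurable M (count_space UNIV)"
    using indep_var_rv1[OF ind] indep_var_rv2[OF ind] by auto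
  have "{\<omega>\<in>space M. X \<omega> + Y \<omega> = n} =
      (\<Union>m\<le>n. {\<omega>\<in>space M. X \<omega> = m \<and> Y \<omega> = n - m})"
    by auto
  also have "prob \<dots> = (\<Sum>m\<le>n. prob {\<omega>\<in>space M. X \<omega> = m \<and> Y \<omega> = n - m})"
    by (intro finite_measure_finite_Union) (auto simp: disjoint_family_on_def)
  also have "\<dots> = (\<Sum>m\<le>n. prob {\<omega>\<in>space M. X \<omega> = m} * prob {\<omega>\<in>space M. Y \<omega> = n - m})"
  proof (rule sum.cong[OF refl])
    fix m
    show "prob {\<omega>\<in>space M. X \<omega> = m \<and> Y \<omega> = n - m} =
        prob {\<omega>\<in>space M. X \<omega> = m} * prob {\<omega>\<in>space M. Y \<omega> = n - m}"
      using prob_indep_random_variable[OF ind, of "{m}" "{n - m}"]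
      by (simp add: vimage_def Int_def conj_commute)
  qed
  finally show ?thesis .
qed

section \<open>Random walks with non-negative integer steps\<close>

text \<open>
  The first step has law \<open>v\<close>, all later steps have law \<open>u\<close>. Since \<open>v 0 = 0\<close>, the walk
  leaves its starting point at once; since \<open>u 0 < 1\<close>, it almost surely does not wait at a site
  forever, which makes the expected occupation numbers finite.
\<close>

locale nat_walk = prob_space M for M :: "'w measure" +
  fixes d :: "nat \<Rightarrow> 'w \<Rightarrow> nat" and v u :: "nat \<Rightarrow> real"
  assumes indep: "indep_vars (\<lambda>_. count_space UNIV) d {1..}"
    and first_step: "\<And>m. prob {\<omega>\<in>space M. d 1 \<omega> = m} = v m"
    and later_step: "\<And>j m. j \<ge> 2 \<Longrightarrow> prob {\<omega>\<in>space M. d j \<omega> = m} = u m"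
    and first_step_nonzero: "v 0 = 0"
    and step_may_move: "u 0 < 1"
begin

definition pos :: "nat \<Rightarrow> 'w \<Rightarrow> nat" where
  "pos k \<omega> = (\<Sum>j = 1..k. d j \<omega>)"

definition occ :: "nat \<Rightarrow> nat \<Rightarrow> real" where
  "occ k n = prob {\<omega>\<in>space M. pos k \<omega> = n}"

text \<open>
  The Green function: the expected number of times \<open>k \<ge> 1\<close> at which the walk is at \<open>n\<close>.
  Time \<open>0\<close> is left out because the step out of it follows \<open>v\<close> instead of \<open>u\<close>.
\<close>

definition green :: "nat \<Rightarrow> real" where
  "green n = (\<Sum>k. occ (Suc k) n)"

lemma pos_0 [simp]: "pos 0 \<omega> = 0"
  by (simp add: pos_def)

lemma pos_Suc [simp]: "pos (Suc k) \<omega> = d (Suc k) \<omega> + pos k \<omega>"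
  by (simp add: pos_def)

lemma step_measurable [measurable]: "d (Suc k) \<in> measurable M (count_space UNIV)"
  using indep unfolding indep_vars_def by auto

lemma pos_measurable [measurable]: "pos k \<in> measurable M (count_space UNIV)"
proof (induction k)
  case 0
  have "pos 0 = (\<lambda>_. 0)" by (simp add: fun_eq_iff)
  then show ?case by simp
next
  case (Suc k)
  note [measurable] = Suc
  have "(\<lambda>\<omega>. d (Suc k) \<omega> + pos k \<omega>) \<in> measurable M (count_space UNIV)"
    by measurable
  then show ?case by (simp add: pos_Suc[abs_def] fun_eq_iff cong: measurable_cong)
qed

lemma pos_mono: "j \<le> k \<Longrightarrow> pos j \<omega> \<le> pos k \<omega>"
  by (induction k rule: dec_induct) auto

text \<open>
  The next step and the present position are functions of disjoint blocks of the independent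
  family.
\<close>

lemma indep_step_pos:
  "indep_var (count_space UNIV) (d (Suc k)) (count_space UNIV) (pos k)"
proof -
  let ?C = "\<lambda>_. count_space (UNIV :: nat set)"
  have "indep_var (?C 0) ((\<lambda>f. f (Suc k)) \<circ> (\<lambda>\<omega>. restrict (\<lambda>i. d i \<omega>) {Suc k}))
      (?C 0) ((\<lambda>f. \<Sum>i\<in>{1..k}. f i) \<circ> (\<lambda>\<omega>. restrict (\<lambda>i. d i \<omega>) {1..k}))"
  proof (rule indep_var_compose[OF indep_var_restrict[OF indep]])
    show "(\<lambda>f. \<Sum>i\<in>{1..k}. f i) \<in> measurable (PiM {1..k} ?C) (?C 0)"
      by (rule measurable_sum_nat) simp
  qed auto
  also have "(\<lambda>f. f (Suc k)) \<circ> (\<lambda>\<omega>. restrict (\<lambda>i. d i \<omega>) {Suc k}) = d (Suc k)"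
    by (auto simp: fun_eq_iff)
  also have "(\<lambda>f. \<Sum>i\<in>{1..k}. f i) \<circ> (\<lambda>\<omega>. restrict (\<lambda>i. d i \<omega>) {1..k}) = pos k"
    by (auto simp: fun_eq_iff pos_def)
  finally show ?thesis .
qed

lemma occ_nonneg: "occ k n \<ge> 0"
  by (simp add: occ_def)

lemma occ_0: "n \<ge> 1 \<Longrightarrow> occ 0 n = 0"
  by (simp add: occ_def)

lemma occ_1: "occ (Suc 0) n = v n"
  using first_step by (simp add: occ_def)

lemma occ_Suc_Suc: "occ (Suc (Suc k)) n = (\<Sum>m\<le>n. u m * occ (Suc k) (n - m))"
  using prob_add_eq_convolution[OF indep_step_pos[of "Suc k"], of n]
  unfolding occ_def by (simp add: later_step)

text \<open>
  The hypothesis \<open>n \<ge> 1\<close> covers \<open>k = 0\<close>: the step out of time \<open>0\<close> does not have the law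
  \<open>u\<close>, but then both sides vanish because the walk is not at \<open>n\<close>.
\<close>

lemma prob_stay: "n \<ge> 1 \<Longrightarrow> prob {\<omega>\<in>space M. pos k \<omega> = n \<and> d (Suc k) \<omega> = 0} = u 0 * occ k n"
proof (cases k)
  case (Suc k')
  have "prob {\<omega>\<in>space M. d (Suc k) \<omega> = 0 \<and> pos k \<omega> = n} =
      prob {\<omega>\<in>space M. d (Suc k) \<omega> = 0} * occ k n"
    using prob_indep_random_variable[OF indep_step_pos[of k], of "{0}" "{n}"]
    by (simp add: occ_def vimage_def Int_def conj_commute)
  then show ?thesis using Suc by (simp add: later_step conj_commute)
qed (simp add: occ_def)

text \<open>
  Being at \<open>n\<close> at time \<open>k + 1\<close> is either an arrival or a wait, and a wait means a zero
  step out of \<open>n\<close>.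
\<close>

lemma prob_arrival:
  assumes "n \<ge> 1"
  shows "prob {\<omega>\<in>space M. pos (Suc k) \<omega> = n \<and> pos k \<omega> \<noteq> n} = occ (Suc k) n - u 0 * occ k n"
proof -
  let ?A = "{\<omega>\<in>space M. pos (Suc k) \<omega> = n}" and ?B = "{\<omega>\<in>space M. pos k \<omega> = n \<and> d (Suc k) \<omega> = 0}"
  have diff: "{\<omega>\<in>space M. pos (Suc k) \<omega> = n \<and> pos k \<omega> \<noteq> n} = ?A - ?B"
    by auto
  have "prob (?A - ?B) = prob ?A - prob ?B"
  proof (rule finite_measure_Diff)
    show "?A \<in> events" by measurable
    show "?B \<in> events" by measurable
  qed auto
  then show ?thesis
    unfolding diff prob_stay[OF assms] occ_def[of "Suc k"] .
qed

text \<open>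
  Because the walk is monotone, it can arrive at \<open>n\<close> only once. The arrival events for
  different times therefore partition the event that \<open>n\<close> is hit.
\<close>

lemma arrival_sums_hit_prob:
  assumes "n \<ge> 1"
  shows "(\<lambda>k. occ (Suc k) n - u 0 * occ k n) sums hit_prob M d n"
proof -
  define A where "A k = {\<omega>\<in>space M. pos (Suc k) \<omega> = n \<and> pos k \<omega> \<noteq> n}" for k
  have "disjoint_family A"
  proof -
    have "A j \<inter> A k = {}" if "j < k" for j k
    proof -
      \<comment> \<open>If both arrivals happened, the position at time \<open>k\<close> would be squeezed to \<open>n\<close>.\<close>
      have "pos (Suc j) \<omega> \<le> pos k \<omega> \<and> pos k \<omega> \<le> pos (Suc k) \<omega>" for \<omega>
        using that by (intro conjI pos_mono) auto
      then have "pos k \<omega> = n" if "pos (Suc j) \<omega> = n" "pos (Suc k) \<omega> = n" for \<omega>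
        using that by (metis le_antisym)
      then show ?thesis unfolding A_def by blast
    qed
    then show ?thesis unfolding disjoint_family_on_def by (metis Int_commute linorder_neqE_nat)
  qed
  moreover have "A k \<in> events" for k
    unfolding A_def by measurable
  then have "range A \<subseteq> events" by blast
  ultimately have "(\<lambda>k. prob (A k)) sums prob (\<Union>k. A k)"
    by (rule finite_measure_UNION[rotated])
  moreover have "(\<Union>k. A k) = {\<omega>\<in>space M. \<exists>k. pos k \<omega> = n}"
  proof -
    have "\<exists>k. pos (Suc k) \<omega> = n \<and> pos k \<omega> \<noteq> n" if "pos k \<omega> = n" for k \<omega>
      using that
    proof (induction k)
      case 0
      then show ?case using assms by simp
    next
      case (Suc k)
      then show ?case by blast
    qed
    then show ?thesis unfolding A_def by blast
  qed
  moreover have "prob (A k) = occ (Suc k) n - u 0 * occ k n" for k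
    unfolding A_def by (rule prob_arrival[OF assms])
  ultimately show ?thesis
    by (simp only: hit_prob_def pos_def)
qed

text \<open>
  Summing the arrival probabilities up to time \<open>N\<close> telescopes, up to the nonnegative term
  \<open>occ N n\<close>, to \<open>1 - u 0\<close> times the occupation sum, and the arrival probabilities have sum
  at most \<open>hit_prob M d n\<close>. So finiteness of the occupation sum comes with the identity itself.
\<close>

lemma summable_occ:
  assumes "n \<ge> 1"
  shows "summable (\<lambda>k. occ k n)"
proof (rule summableI_nonneg_bounded)
  fix N
  have "(1 - u 0) * (\<Sum>k<N. occ k n) \<le> (\<Sum>k<N. occ (Suc k) n - u 0 * occ k n)"
  proof -
    have "(\<Sum>k<N. occ (Suc k) n) = (\<Sum>k<N. occ k n) + occ N n"
      using sum.lessThan_Suc_shift[of "\<lambda>k. occ k n" N] occ_0[OF assms] by simp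
    then show ?thesis
      using occ_nonneg[of N n] by (simp add: sum_subtractf sum_distrib_left algebra_simps)
  qed
  also have "\<dots> \<le> hit_prob M d n"
  proof -
    have "0 \<le> occ (Suc k) n - u 0 * occ k n" for k
      unfolding prob_arrival[OF assms, symmetric] by (rule measure_nonneg)
    then show ?thesis
      using arrival_sums_hit_prob[OF assms] sum_le_suminf[of "\<lambda>k. occ (Suc k) n - u 0 * occ k n" "{..<N}"]
      by (simp add: sums_iff)
  qed
  finally show "(\<Sum>k<N. occ k n) \<le> hit_prob M d n / (1 - u 0)"
    using step_may_move by (simp add: field_simps)
qed (rule occ_nonneg)

lemma occ_Suc_0: "occ (Suc k) 0 = 0"
  by (induction k) (simp_all add: occ_1 first_step_nonzero occ_Suc_Suc)

lemma green_sums: "(\<lambda>k. occ (Suc k) n) sums green n"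
proof (cases "n = 0")
  case True
  then show ?thesis by (simp add: green_def occ_Suc_0)
next
  case False
  then have "summable (\<lambda>k. occ (Suc k) n)"
    by (intro summable_Suc_iff[THEN iffD2] summable_occ) simp
  then show ?thesis
    unfolding green_def by (rule summable_sums)
qed

lemma green_0: "green 0 = 0"
  by (simp add: green_def occ_Suc_0)

text \<open>
  Both terms of the arrival probability \<open>occ (Suc k) n - u 0 * occ k n\<close> sum to a multiple of
  the Green function; the shift in the first costs nothing since \<open>occ 0 n = 0\<close>.
\<close>

lemma hit_prob_eq_green:
  assumes "n \<ge> 1"
  shows "hit_prob M d n = (1 - u 0) * green n"
proof -
  have "(\<lambda>k. occ k n) sums green n"
    using sums_Suc_iff[THEN iffD1, OF green_sums[of n]] by (simp add: occ_0[OF assms])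
  then have "(\<lambda>k. occ (Suc k) n - u 0 * occ k n) sums (green n - u 0 * green n)"
    by (intro sums_diff sums_mult green_sums)
  from sums_unique2[OF arrival_sums_hit_prob[OF assms] this] show ?thesis
    by (simp add: left_diff_distrib)
qed

lemma hit_prob_0: "hit_prob M d 0 = 1"
proof -
  have "{\<omega>\<in>space M. \<exists>k::nat. (\<Sum>j = 1..k. d j \<omega>) = 0} = space M"
  proof -
    have "\<exists>k::nat. (\<Sum>j = 1..k. d j \<omega>) = 0" for \<omega>
      by (rule exI[of _ 0]) simp
    then show ?thesis by blast
  qed
  then show ?thesis by (simp only: hit_prob_def prob_space)
qed

text \<open>
  At time \<open>1\<close> the position is the first step; at every later time it is an independent step of
  law \<open>u\<close> added to a position at a time \<open>k \<ge> 1\<close>. Summing the convolution over time gives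
  the product of series.
\<close>

lemma green_renewal: "Abs_fps green = Abs_fps v + Abs_fps u * Abs_fps green"
proof (rule fps_ext)
  fix n
  have "(\<lambda>k. occ (Suc (Suc k)) n) sums (\<Sum>m\<le>n. u m * green (n - m))"
    unfolding occ_Suc_Suc by (intro sums_sum sums_mult green_sums)
  then have "(\<lambda>k. occ (Suc k) n) sums ((\<Sum>m\<le>n. u m * green (n - m)) + occ (Suc 0) n)"
    by (rule sums_Suc_iff[THEN iffD1])
  from sums_unique2[OF green_sums this] have "green n = v n + (\<Sum>m\<le>n. u m * green (n - m))"
    by (simp add: occ_1)
  also have "\<dots> = fps_nth (Abs_fps v + Abs_fps u * Abs_fps green) n"
    by (simp add: fps_mult_nth atMost_atLeast0)
  finally show "fps_nth (Abs_fps green) n = fps_nth (Abs_fps v + Abs_fps u * Abs_fps green) n"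
    by simp
qed

text \<open>
  The Green function is eliminated from the renewal equation. The constant coefficient needs its
  own argument, as the site \<open>0\<close> is hit by the empty sum.
\<close>

theorem hit_prob_fps_eq:
  "(Abs_fps (hit_prob M d) - 1) * (1 - Abs_fps u) = fps_const (1 - u 0) * Abs_fps v"
proof -
  have "Abs_fps (hit_prob M d) = 1 + fps_const (1 - u 0) * Abs_fps green"
  proof (rule fps_ext)
    fix n
    show "fps_nth (Abs_fps (hit_prob M d)) n = fps_nth (1 + fps_const (1 - u 0) * Abs_fps green) n"
      by (cases "n = 0") (simp_all add: hit_prob_0 green_0 hit_prob_eq_green)
  qed
  moreover have "Abs_fps green * (1 - Abs_fps u) = Abs_fps v"
  proof -
    have "Abs_fps green * (1 - Abs_fps u) = Abs_fps green - Abs_fps u * Abs_fps green"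
      by (simp add: algebra_simps)
    also have "\<dots> = Abs_fps v"
      using green_renewal by (metis add_diff_cancel_right')
    finally show ?thesis .
  qed
  ultimately show ?thesis by (simp add: mult.assoc)
qed

end

section \<open>Uniform digits in base \<open>b\<close>\<close>

text \<open>
  The uniform law on \<open>b\<close> consecutive numbers has a geometric sum as generating function.
  Clearing denominators keeps the identity inside the ring of power series. It serves for the
  later digits with \<open>l = 0\<close>, and for the first digit with \<open>l = 1\<close> and \<open>b - 1\<close> values.
\<close>

lemma uniform_fps_times:
  fixes l b :: nat
  defines "c \<equiv> pmf (pmf_of_set {l..<l + b})"
  assumes "b \<ge> 1"
  shows "of_nat b * (1 - fps_X) * Abs_fps c = fps_X ^ l * (1 - fps_X ^ b :: real fps)"
proof -
  have "of_nat b * Abs_fps c = (\<Sum>i<b. fps_X ^ (l + i) :: real fps)"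
  proof (rule fps_ext)
    fix n
    have "fps_nth (\<Sum>i<b. fps_X ^ (l + i) :: real fps) n = (\<Sum>i<b. if n = l + i then 1 else 0)"
      by (simp add: fps_sum_nth fps_X_power_iff)
    also have "\<dots> = (if l \<le> n \<and> n < l + b then 1 else 0)"
    proof -
      have "(n = l + i) = (l \<le> n \<and> i = n - l)" for i by auto
      then show ?thesis by (auto simp: sum.delta')
    qed
    finally show "fps_nth (of_nat b * Abs_fps c) n = fps_nth (\<Sum>i<b. fps_X ^ (l + i) :: real fps) n"
      using assms(2) by (simp add: c_def fps_of_nat[symmetric] indicator_def)
  qed
  also have "\<dots> = fps_X ^ l * (\<Sum>i<b. fps_X ^ i)"
    by (simp add: power_add sum_distrib_left)
  finally have "of_nat b * Abs_fps c * (1 - fps_X) = fps_X ^ l * ((1 - fps_X) * (\<Sum>i<b. fps_X ^ i))"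
    by (simp add: mult_ac)
  then show ?thesis by (simp add: one_diff_power_eq mult_ac)
qed

theorem theorem1:
  fixes b :: nat
    and M :: "'w measure"
    and d :: "nat \<Rightarrow> 'w \<Rightarrow> nat"
  assumes "b \<ge> 2"
    and "prob_space M"
    and "prob_space.indep_vars M (\<lambda>_. count_space UNIV) d {1..}"
    and "distr M (count_space UNIV) (d 1) = measure_pmf (pmf_of_set {1..b - 1})"
    and "\<And>j. j \<ge> 2 \<Longrightarrow> distr M (count_space UNIV) (d j) = measure_pmf (pmf_of_set {0..b - 1})"
  shows "Abs_fps (hit_prob M d) =
    1 + fps_X * (1 - fps_X ^ (b - 1)) / ((of_nat b - 1) * (1 - fps_X))
      + (- 1 + fps_X ^ (b - 1)) ^ 2 * fps_X ^ 2
        / ((- (of_nat b * fps_X) + fps_X ^ b + of_nat b - 1) * (of_nat b - 1) * (1 - fps_X))"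
proof -
  interpret prob_space M by fact
  define v where "v = pmf (pmf_of_set {1..b - 1})"
  define u where "u = pmf (pmf_of_set {0..b - 1})"
  have step: "prob {\<omega>\<in>space M. d j \<omega> = m} = pmf p m"
    if "j \<ge> 1" "distr M (count_space UNIV) (d j) = measure_pmf p" for j m p
  proof -
    have "d j \<in> measurable M (count_space UNIV)"
      using assms(3) that(1) unfolding indep_vars_def by auto
    then have "prob {\<omega>\<in>space M. d j \<omega> = m} = measure (distr M (count_space UNIV) (d j)) {m}"
      by (subst measure_distr) (auto simp: vimage_def Int_def conj_commute)
    then show ?thesis by (simp add: that(2) measure_pmf_single)
  qed
  have u0: "u 0 = 1 / b" and v0: "v 0 = 0"
    using assms(1) by (simp_all add: u_def v_def)
  interpret nat_walk M d v u
  proof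
    show "u 0 < 1" using assms(1) by (simp add: u0)
  qed (use assms step v0 in \<open>auto simp: u_def v_def\<close>)

  define X :: "real fps" where "X = fps_X"
  define B :: "real fps" where "B = of_nat b"
  define V where "V = Abs_fps v"
  define U where "U = Abs_fps u"
  define H where "H = Abs_fps (hit_prob M d) - 1"
  define Y where "Y = X * (1 - X ^ (b - 1))"
  define Q where "Q = - (B * X) + X ^ b + B - 1"
  have V: "(B - 1) * (1 - X) * V = Y"
  proof -
    have "{1..<1 + (b - 1)} = {1..b - 1}" by auto
    then show ?thesis
      using uniform_fps_times[of "b - 1" 1] assms(1)
      by (simp add: B_def X_def V_def Y_def v_def of_nat_diff)
  qed
  have U: "B * (1 - X) * (1 - U) = Q"
  proof -
    have "{0..<b} = {0..b - 1}" using assms(1) by auto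
    then show ?thesis
      using uniform_fps_times[of b 0] assms(1)
      by (simp add: B_def X_def U_def Q_def u_def algebra_simps)
  qed
  have B: "B * fps_const (1 - u 0) = B - 1"
    using assms(1) by (simp add: B_def u0 fps_eq_iff fps_of_nat[symmetric] field_simps)
  have "Q * H = B * (1 - X) * (H * (1 - U))"
    by (simp add: U[symmetric] mult_ac)
  also have "H * (1 - U) = fps_const (1 - u 0) * V"
    unfolding H_def U_def V_def by (rule hit_prob_fps_eq)
  also have "B * (1 - X) * (fps_const (1 - u 0) * V) = (B * fps_const (1 - u 0)) * (1 - X) * V"
    by (simp only: mult_ac)
  finally have QH: "Q * H = Y"
    by (simp only: B V)
  have X_pow: "X ^ b = X * X ^ (b - 1)"
    using assms(1) by (simp flip: power_Suc)
  \<comment> \<open>This cancellation is why the two fractions of the closed form combine into \<open>Y / Q\<close>.\<close>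
  have QY: "Q + Y = (B - 1) * (1 - X)"
    by (simp add: Q_def Y_def X_pow algebra_simps)
  define C where "C = (B - 1) * (1 - X)"
  have b_real: "real b - 1 \<noteq> 0"
    using assms(1) by simp
  have Q0: "fps_nth Q 0 \<noteq> 0" and C0: "fps_nth C 0 \<noteq> 0"
    using assms(1) b_real by (simp_all add: Q_def C_def B_def X_def)
  have "Y / C + (- 1 + X ^ (b - 1)) ^ 2 * X ^ 2 / (Q * (B - 1) * (1 - X)) = Y / C + Q * (H * Y) / (Q * C)"
  proof -
    have "(- 1 + X ^ (b - 1)) ^ 2 * X ^ 2 = Y * Y"
      by (simp add: Y_def power2_eq_square algebra_simps)
    also have "\<dots> = Q * (H * Y)"
      by (simp only: QH[symmetric] mult_ac)
    finally show ?thesis by (simp only: C_def mult.assoc)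
  qed
  also have "Q * (H * Y) / (Q * C) = H * Y / C"
    using Q0 by (intro div_mult_mult1) auto
  also have "Y / C + H * Y / C = H * (Q + Y) * inverse C"
    using C0 by (simp add: fps_divide_unit algebra_simps flip: QH)
  also have "\<dots> = H"
    using inverse_mult_eq_1'[OF C0] by (simp add: QY C_def[symmetric] mult.assoc)
  finally have "Abs_fps (hit_prob M d) =
      1 + (Y / C + (- 1 + X ^ (b - 1)) ^ 2 * X ^ 2 / (Q * (B - 1) * (1 - X)))"
    by (simp add: H_def)
  then show ?thesis
    by (simp only: Y_def C_def Q_def B_def X_def add.assoc)
qed

end
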